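(* If $G$ is a connected non-complete graph with at least $4$ vertices, then $\mu_5(G)\ge 3$. Equality holds if and only if $\omega(G)\ge 4$ or $\mathrm{diam}(G)\ge 3$.
   Context: All graphs are finite, undirected, simple and connected. The distance matrix $\mathcal{D}(G)$ of a graph $G$ on vertices $1,\dots,n$ is the $n\times n$ matrix whose $(i,j)$ entry is the length of a shortest path from $i$ to $j$. A real number $\lambda$ is a Pareto eigenvalue of a real $n\times n$ matrix $A$ if there is a nonzero vector $\mathbf{x}\in\mathbb{R}^n$, $\mathbf{x}\ge 0$ (entrywise), with $A\mathbf{x}\ge\lambda\mathbf{x}$ (entrywise) and $\lambda=\frac{\mathbf{x}^TA\mathbf{x}}{\mathbf{x}^T\mathbf{x}}$. The distance Pareto eigenvalues of $G$ are the Pareto eigenvalues of $\mathcal{D}(G)$. $\mu_k(G)$ denotes the $k$-th smallest element of the set of distinct distance Pareto eigenvalues of $G$. $\omega(G)$ is the clique number (the largest order of a complete subgraph) and $\mathrm{diam}(G)$ is the maximum distance between two vertices of $G$. *)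

theory Defs
  imports "HOL-Analysis.Analysis" "Graph_Theory.Graph_Theory"
begin

text \<open>
  Finite simple undirected graphs are the symmetric loop-free digraphs without parallel arcs,
  i.e. the locale \<^locale>\<open>Digraph.graph\<close>; an edge is a pair of opposite arcs.  To index the
  distance matrix by the vertices, the vertex set of a graph is taken to be the universe of a
  finite type.
\<close>

definition graph_dist :: "('a, 'b) pre_digraph \<Rightarrow> 'a \<Rightarrow> 'a \<Rightarrow> nat" where
  "graph_dist G u v = (LEAST k. \<exists>p. pre_digraph.apath G u p v \<and> length p = k)"

definition distance_matrix :: "('n::finite, 'b) pre_digraph \<Rightarrow> real ^ 'n ^ 'n" where
  "distance_matrix G = (\<chi> i j. real (graph_dist G i j))"

definition graph_diameter :: "('a, 'b) pre_digraph \<Rightarrow> nat" where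
  "graph_diameter G = Max {graph_dist G u v | u v. u \<in> verts G \<and> v \<in> verts G}"

definition clique_number :: "('a, 'b) pre_digraph \<Rightarrow> nat" where
  "clique_number G = Max {k. \<exists>H. subgraph H G \<and> complete_digraph k H}"

definition pareto_eigenvalue :: "real ^ 'n ^ 'n \<Rightarrow> real \<Rightarrow> bool" where
  "pareto_eigenvalue A \<mu> \<longleftrightarrow>
     (\<exists>x :: real ^ 'n. x \<noteq> 0 \<and> (\<forall>i. x $ i \<ge> 0) \<and> (\<forall>i. (A *v x) $ i \<ge> \<mu> * x $ i)
        \<and> \<mu> = (x \<bullet> (A *v x)) / (x \<bullet> x))"

definition distance_pareto_eigenvalues :: "('n::finite, 'b) pre_digraph \<Rightarrow> real set" where
  "distance_pareto_eigenvalues G = {\<mu>. pareto_eigenvalue (distance_matrix G) \<mu>}"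

text \<open>
  The \<open>k\<close>-th smallest element counts from \<open>k = 1\<close>.  The finiteness condition is needed because
  the cardinality of an infinite set is \<open>0\<close>.
\<close>

definition kth_smallest :: "nat \<Rightarrow> real set \<Rightarrow> real" where
  "kth_smallest k S = (THE x. x \<in> S \<and> finite {y \<in> S. y < x} \<and> Suc (card {y \<in> S. y < x}) = k)"

definition distance_pareto_mu :: "nat \<Rightarrow> ('n::finite, 'b) pre_digraph \<Rightarrow> real" where
  "distance_pareto_mu k G = kth_smallest k (distance_pareto_eigenvalues G)"

end

theory Submission
  imports Defs
begin

text \<open>
  For a nonnegative matrix a Pareto eigenvalue is exactly an eigenvalue of a principal submatrix
  with a strictly positive eigenvector.  Column sums of the distance submatrix on a vertex set
  \<open>J\<close> are at least \<open>card J - 1\<close>, so eigenvalues at most \<open>3\<close> come from \<open>card J \<le> 3\<close> or from a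
  \<open>4\<close>-clique.  Three vertices give \<open>2\<close> (a triangle), \<open>1 + sqrt 3\<close> (distances \<open>1, 1, 2\<close>) or
  something larger than \<open>3\<close>; two vertices give their distance.  Hence below \<open>3\<close> there are only
  \<open>0, 1, 2, 1 + sqrt 3\<close>, all of which occur as soon as two vertices have distance \<open>2\<close>, and \<open>3\<close>
  itself occurs only from a \<open>4\<close>-clique or a pair at distance \<open>3\<close>.  The maximum of the quadratic
  form on the nonnegative part of the unit sphere is a Pareto eigenvalue that is at least
  \<open>card (verts G) - 1\<close>.
\<close>

section \<open>Pareto eigenvalues of nonnegative symmetric matrices\<close>

text \<open>Complementarity: the formula for \<open>\<mu>\<close> makes the nonnegative terms
  \<open>x $ i * ((A *v x) $ i - \<mu> * x $ i)\<close> sum to zero, so each vanishes, and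
  \<open>J\<close> is the support of \<open>x\<close>. Conversely \<open>w\<close> is extended by
  zero; outside \<open>J\<close> the inequality reduces to nonnegativity of the entries of
  \<open>A\<close>.\<close>

lemma pareto_eigenvalue_iff_support:
  fixes A :: "real ^ 'n::finite ^ 'n"
  assumes nonneg: "\<And>i j. A $ i $ j \<ge> 0"
  shows "pareto_eigenvalue A \<mu> \<longleftrightarrow>
    (\<exists>J w. J \<noteq> {} \<and> (\<forall>i\<in>J. w i > 0) \<and> (\<forall>i\<in>J. (\<Sum>j\<in>J. A $ i $ j * w j) = \<mu> * w i))"
    (is "?L \<longleftrightarrow> ?R")
proof
  assume ?L
  then obtain x where x: "x \<noteq> 0" "\<And>i. x $ i \<ge> 0" "\<And>i. (A *v x) $ i \<ge> \<mu> * x $ i"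
    and mu: "\<mu> = (x \<bullet> (A *v x)) / (x \<bullet> x)"
    unfolding pareto_eigenvalue_def by blast
  have "x \<bullet> (A *v x) = \<mu> * (x \<bullet> x)"
    using x(1) mu by simp
  then have "(\<Sum>i\<in>UNIV. x $ i * ((A *v x) $ i - \<mu> * x $ i)) = 0"
    by (simp add: inner_vec_def algebra_simps sum_subtractf sum_distrib_left)
  moreover have "x $ i * ((A *v x) $ i - \<mu> * x $ i) \<ge> 0" for i
    using x by simp
  ultimately have "\<forall>i\<in>UNIV. x $ i * ((A *v x) $ i - \<mu> * x $ i) = 0"
    by (subst (asm) sum_nonneg_eq_0_iff) auto
  then have eq: "(A *v x) $ i = \<mu> * x $ i" if "x $ i > 0" for i
    using that by (metis UNIV_I eq_iff_diff_eq_0 less_irrefl mult_eq_0_iff)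
  define J where "J = {i. x $ i > 0}"
  have zero: "x $ i = 0" if "i \<notin> J" for i
    using that x(2)[of i] by (simp add: J_def)
  have "J \<noteq> {}"
    using x(1) zero by (auto simp: vec_eq_iff)
  moreover have "(\<Sum>j\<in>J. A $ i $ j * x $ j) = (A *v x) $ i" for i
    unfolding matrix_vector_mult_def using zero by (auto intro!: sum.mono_neutral_left)
  ultimately show ?R
    using eq by (intro exI[of _ J] exI[of _ "\<lambda>i. x $ i"]) (auto simp: J_def)
next
  assume ?R
  then obtain J w where J: "J \<noteq> {}" "\<And>i. i \<in> J \<Longrightarrow> w i > 0"
    and eq: "\<And>i. i \<in> J \<Longrightarrow> (\<Sum>j\<in>J. A $ i $ j * w j) = \<mu> * w i"
    by blast
  define x :: "real ^ 'n" where "x = (\<chi> i. if i \<in> J then w i else 0)"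
  have x0: "x \<noteq> 0"
  proof -
    obtain i where "i \<in> J" using J(1) by blast
    then have "x $ i > 0" using J(2) by (simp add: x_def)
    then show ?thesis by auto
  qed
  have xpos: "x $ i \<ge> 0" for i
    using J(2) by (simp add: x_def less_imp_le)
  have Ax: "(A *v x) $ i = (\<Sum>j\<in>J. A $ i $ j * w j)" for i
    unfolding matrix_vector_mult_def x_def
    by (simp add: if_distrib[of "\<lambda>t. _ * t"] sum.If_cases)
  have ge: "(A *v x) $ i \<ge> \<mu> * x $ i" for i
  proof (cases "i \<in> J")
    case True
    then show ?thesis using eq Ax by (simp add: x_def)
  next
    case False
    then show ?thesis using Ax[of i] J(2) nonneg
      by (auto simp: x_def less_imp_le intro!: sum_nonneg)
  qed
  have "x \<bullet> (A *v x) = \<mu> * (x \<bullet> x)"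
    unfolding inner_vec_def sum_distrib_left
    using eq Ax by (intro sum.cong) (auto simp: x_def)
  then have "\<mu> = (x \<bullet> (A *v x)) / (x \<bullet> x)"
    using x0 by simp
  with x0 xpos ge show ?L
    unfolding pareto_eigenvalue_def by blast
qed

text \<open>By symmetry the bilinear form of \<open>A\<close> on \<open>J\<close>, evaluated at
  \<open>v\<close> and \<open>w\<close>, is both \<open>\<mu>\<close> and \<open>\<nu>\<close> times
  the inner product of \<open>v\<close> and \<open>w\<close>, which is positive.\<close>

lemma support_determines_pareto_eigenvalue:
  fixes A :: "real ^ 'n::finite ^ 'n"
  assumes sym: "\<And>i j. A $ i $ j = A $ j $ i"
    and J: "J \<noteq> {}" "\<And>i. i \<in> J \<Longrightarrow> v i > 0" "\<And>i. i \<in> J \<Longrightarrow> w i > 0"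
    and v: "\<And>i. i \<in> J \<Longrightarrow> (\<Sum>j\<in>J. A $ i $ j * v j) = \<mu> * v i"
    and w: "\<And>i. i \<in> J \<Longrightarrow> (\<Sum>j\<in>J. A $ i $ j * w j) = \<nu> * w i"
  shows "\<mu> = \<nu>"
proof -
  have "\<mu> * (\<Sum>i\<in>J. v i * w i) = (\<Sum>i\<in>J. (\<Sum>j\<in>J. A $ i $ j * v j) * w i)"
    unfolding sum_distrib_left using v by (intro sum.cong) auto
  also have "\<dots> = (\<Sum>i\<in>J. \<Sum>j\<in>J. A $ i $ j * v j * w i)"
    by (simp add: sum_distrib_right)
  also have "\<dots> = (\<Sum>j\<in>J. \<Sum>i\<in>J. A $ i $ j * v j * w i)"
    by (rule sum.swap)
  also have "\<dots> = (\<Sum>j\<in>J. v j * (\<Sum>i\<in>J. A $ j $ i * w i))"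
    using sym by (simp add: sum_distrib_left algebra_simps)
  also have "\<dots> = \<nu> * (\<Sum>i\<in>J. v i * w i)"
    unfolding sum_distrib_left[of \<nu>]
    using w by (intro sum.cong) (simp_all only: mult.left_commute)
  finally have "\<mu> * (\<Sum>i\<in>J. v i * w i) = \<nu> * (\<Sum>i\<in>J. v i * w i)" .
  moreover have "(\<Sum>i\<in>J. v i * w i) > 0"
    using J by (intro sum_pos) auto
  ultimately show ?thesis by simp
qed

text \<open>Choosing a support for each Pareto eigenvalue is injective, and there are only finitely
  many vertex sets.\<close>

lemma finite_pareto_eigenvalues:
  fixes A :: "real ^ 'n::finite ^ 'n"
  assumes nonneg: "\<And>i j. A $ i $ j \<ge> 0" and sym: "\<And>i j. A $ i $ j = A $ j $ i"
  shows "finite {\<mu>. pareto_eigenvalue A \<mu>}"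
proof -
  define Q where "Q \<mu> J w \<longleftrightarrow> J \<noteq> {} \<and> (\<forall>i\<in>J. w i > 0) \<and>
    (\<forall>i\<in>J. (\<Sum>j\<in>J. A $ i $ j * w j) = \<mu> * w i)" for \<mu> J and w :: "'n \<Rightarrow> real"
  have "\<exists>J w. Q \<mu> J w" if "pareto_eigenvalue A \<mu>" for \<mu>
    using that unfolding Q_def pareto_eigenvalue_iff_support[OF nonneg] .
  then obtain S w where S: "\<And>\<mu>. pareto_eigenvalue A \<mu> \<Longrightarrow> Q \<mu> (S \<mu>) (w \<mu>)"
    by metis
  have "inj_on S {\<mu>. pareto_eigenvalue A \<mu>}"
  proof (rule inj_onI)
    fix \<mu> \<nu>
    assume "\<mu> \<in> {\<mu>. pareto_eigenvalue A \<mu>}" "\<nu> \<in> {\<mu>. pareto_eigenvalue A \<mu>}" and eq: "S \<mu> = S \<nu>"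
    then have "Q \<mu> (S \<mu>) (w \<mu>)" "Q \<nu> (S \<mu>) (w \<nu>)"
      using S[of \<mu>] S[of \<nu>] by simp_all
    then show "\<mu> = \<nu>"
      unfolding Q_def
      by (intro support_determines_pareto_eigenvalue[OF sym, of "S \<mu>" "w \<mu>" "w \<nu>" \<mu> \<nu>]) blast+
  qed
  then show ?thesis
    by (rule inj_on_finite[of _ _ UNIV]) auto
qed

text \<open>A maximiser of the quadratic form on the compact nonnegative part of the unit sphere
  satisfies the first-order conditions, which turn the maximum into a Pareto eigenvalue.\<close>

lemma ex_pareto_eigenvalue_ge_quadratic_form:
  fixes A :: "real ^ 'n::finite ^ 'n"
  assumes nonneg: "\<And>i j. A $ i $ j \<ge> 0" and sym: "\<And>i j. A $ i $ j = A $ j $ i"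
    and v: "v \<noteq> 0" "\<And>i. v $ i \<ge> 0"
  shows "\<exists>\<mu>. pareto_eigenvalue A \<mu> \<and> \<mu> \<ge> (v \<bullet> (A *v v)) / (v \<bullet> v)"
proof -
  define K where "K = sphere (0 :: real ^ 'n) 1 \<inter> {x. \<forall>i. x $ i \<ge> 0}"
  define q where "q x = x \<bullet> (A *v x)" for x
  have hom: "q (c *\<^sub>R x) = c\<^sup>2 * q x" for c x
    by (simp add: q_def matrix_vector_mult_scaleR power2_eq_square)
  have "closed {x :: real ^ 'n. \<forall>i. x $ i \<ge> 0}"
    by (intro closed_Collect_all closed_Collect_le continuous_intros)
  then have "compact K"
    unfolding K_def by (intro compact_Int_closed) auto
  moreover have inK: "(1 / norm y) *\<^sub>R y \<in> K" if "y \<noteq> 0" "\<And>i. y $ i \<ge> 0" for y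
    using that by (simp add: K_def)
  then have "K \<noteq> {}"
    using v by blast
  moreover have "continuous_on K q"
    unfolding q_def by (intro continuous_intros)
  ultimately obtain x where xK: "x \<in> K" and max: "\<And>y. y \<in> K \<Longrightarrow> q y \<le> q x"
    using continuous_attains_sup[of K q] by blast
  have x: "x \<noteq> 0" "\<And>i. x $ i \<ge> 0" "norm x = 1"
    using xK by (auto simp: K_def)
  then have xx: "x \<bullet> x = 1"
    by (simp add: norm_eq_1)
  \<comment> \<open>Homogeneity carries maximality from the sphere to the whole nonnegative orthant,
    so perturbations need no normalisation.\<close>
  have bound: "q y \<le> q x * (y \<bullet> y)" if "\<And>i. y $ i \<ge> 0" for y
  proof (cases "y = 0")
    case True
    then show ?thesis by (simp add: q_def)
  next
    case False
    have "q y / (norm y)\<^sup>2 \<le> q x"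
      using max[OF inK[OF False that]] by (simp add: hom power_divide)
    then show ?thesis
      using False by (simp add: divide_le_eq power2_norm_eq_inner)
  qed
  have le: "(A *v x) $ i \<le> q x * x $ i" for i
  proof (rule ccontr)
    assume neg: "\<not> ?thesis"
    define d where "d = (A *v x) $ i - q x * x $ i"
    define b where "b = A $ i $ i - q x"
    have d: "d > 0" using neg by (simp add: d_def)
    have adj: "u \<bullet> (A *v w) = w \<bullet> (A *v u)" for u w
    proof -
      have "transpose A = A"
        using sym by (simp add: transpose_def vec_eq_iff)
      then have "u \<bullet> (A *v w) = (A *v u) \<bullet> w"
        by (metis dot_lmul_matrix transpose_matrix_vector)
      then show ?thesis by (simp add: inner_commute)
    qed
    \<comment> \<open>Maximality of \<open>x\<close> against the perturbation \<open>x + t *\<^sub>R axis i 1\<close>.\<close>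
    have key: "2 * t * d + t\<^sup>2 * b \<le> 0" if "t > 0" for t
    proof -
      define y where "y = x + t *\<^sub>R axis i 1"
      have "q y \<le> q x * (y \<bullet> y)"
        using x(2) that by (intro bound) (simp add: y_def axis_def)
      moreover have "q y = q x + 2 * t * (A *v x) $ i + t\<^sup>2 * A $ i $ i"
        using adj[of x "axis i 1"]
        by (simp add: q_def y_def matrix_vector_right_distrib matrix_vector_mult_scaleR
            inner_add_left inner_add_right inner_axis' matrix_vector_mult_basis column_def
            power2_eq_square distrib_left mult.assoc)
      moreover have "y \<bullet> y = 1 + 2 * t * x $ i + t\<^sup>2"
        by (simp add: y_def inner_add_left inner_add_right inner_axis inner_axis' xx
            power2_eq_square distrib_left)
      ultimately show ?thesis
        by (simp add: d_def b_def algebra_simps)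
    qed
    \<comment> \<open>Small enough that \<open>t * \<bar>b\<bar> \<le> d\<close>, so the linear term
      \<open>2 * d\<close> dominates and contradicts \<open>key\<close>.\<close>
    define t where "t = d / (\<bar>b\<bar> + 1)"
    have t: "t > 0" using d by (simp add: t_def)
    have "t * (2 * d + t * b) \<le> 0"
      using key[OF t] by (simp add: algebra_simps power2_eq_square)
    then have "2 * d + t * b \<le> 0"
      using t by (simp add: mult_le_0_iff)
    moreover have "t * \<bar>b\<bar> \<le> d"
      using d by (simp add: t_def field_simps)
    moreover have "t * b \<ge> - (t * \<bar>b\<bar>)"
      using t by (metis abs_ge_minus_self abs_mult abs_of_pos minus_le_iff)
    ultimately show False using d by linarith
  qed
  \<comment> \<open>The upper bound \<open>le\<close> has the opposite direction to the definition.
    Complementarity makes it an equality where \<open>x $ i > 0\<close>; where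
    \<open>x $ i = 0\<close>, nonnegativity of \<open>A\<close> suffices.\<close>
  define c where "c = q x"
  have "(\<Sum>i\<in>UNIV. x $ i * (c * x $ i - (A *v x) $ i)) = c * (x \<bullet> x) - x \<bullet> (A *v x)"
    by (simp add: inner_vec_def algebra_simps sum_subtractf sum_distrib_left)
  also have "\<dots> = 0" by (simp add: xx c_def q_def)
  finally have "(\<Sum>i\<in>UNIV. x $ i * (c * x $ i - (A *v x) $ i)) = 0" .
  then have zero: "x $ i = 0 \<or> (A *v x) $ i = c * x $ i" for i
    using le x(2) by (subst (asm) sum_nonneg_eq_0_iff) (auto simp: c_def)
  have "(A *v x) $ i \<ge> 0" for i
    unfolding matrix_vector_mult_def using nonneg x(2) by (auto intro!: sum_nonneg)
  with zero have "(A *v x) $ i \<ge> q x * x $ i" for i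
    by (metis c_def mult_zero_right order_refl)
  then have "pareto_eigenvalue A (q x)"
    unfolding pareto_eigenvalue_def using x xx by (intro exI[of _ x]) (simp add: q_def)
  moreover have "(v \<bullet> (A *v v)) / (v \<bullet> v) \<le> q x"
    using bound[of v] v by (simp add: q_def divide_le_eq)
  ultimately show ?thesis by blast
qed

section \<open>Integer-valued metrics on a finite set\<close>

text \<open>
  If two of \<open>p, q, r\<close> are at least \<open>2\<close>, then all three column sums are at least \<open>3\<close> and one is at
  least \<open>4\<close>, which forces \<open>\<mu> > 3\<close>.
\<close>

lemma triangle_equation_root:
  fixes p q r \<mu> x y z :: real
  assumes ge1: "p \<ge> 1" "q \<ge> 1" "r \<ge> 1"
    and int: "p = 1 \<or> p \<ge> 2" "q = 1 \<or> q \<ge> 2" "r = 1 \<or> r \<ge> 2"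
    and tri: "p \<le> q + r" "q \<le> p + r" "r \<le> p + q"
    and pos: "x > 0" "y > 0" "z > 0"
    and eq: "\<mu> * x = p * y + q * z" "\<mu> * y = p * x + r * z" "\<mu> * z = q * x + r * y"
    and le: "\<mu> \<le> 3"
  shows "\<mu> = 2 \<or> \<mu> = 1 + sqrt 3"
proof -
  have sum: "\<mu> * (x + y + z) = (p + q) * x + (p + r) * y + (q + r) * z"
    using eq by (simp add: algebra_simps)
  have le3: "\<mu> * (x + y + z) \<le> 3 * (x + y + z)"
    using le pos by (intro mult_right_mono) auto
  have two: False if "a * x + b * y + c * z \<le> 3 * (x + y + z)" "a \<ge> 3" "b \<ge> 3" "c \<ge> 3"
    "a \<ge> 4 \<or> b \<ge> 4 \<or> c \<ge> 4" for a b c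
  proof -
    have "(a - 3) * x + (b - 3) * y + (c - 3) * z \<le> 0"
      using that(1) by (simp add: algebra_simps)
    moreover have "(a - 3) * x \<ge> 0" "(b - 3) * y \<ge> 0" "(c - 3) * z \<ge> 0"
      using that pos by simp_all
    moreover have "(a - 3) * x > 0 \<or> (b - 3) * y > 0 \<or> (c - 3) * z > 0"
      using that(5) pos by auto
    ultimately show False by linarith
  qed
  \<comment> \<open>The case of distances 1, 1, 2, with \<open>c\<close> the weight of the midpoint.
    Eliminating \<open>a\<close> and \<open>b\<close> leaves
    \<open>\<mu>\<^sup>2 - 2 * \<mu> - 2 = 0\<close>, and positivity of the weights excludes the
    smaller root.\<close>
  have long: "\<mu> = 1 + sqrt 3"
    if e: "\<mu> * a = 2 * b + c" "\<mu> * b = 2 * a + c" "\<mu> * c = a + b" and c: "a > 0" "b > 0" "c > 0"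
    for a b c
  proof -
    have "(\<mu>\<^sup>2 - 2 * \<mu> - 2) * c = \<mu> * (\<mu> * c) - 2 * (\<mu> * c) - 2 * c"
      by (simp add: algebra_simps power2_eq_square)
    also have "\<dots> = (\<mu> * a + \<mu> * b) - 2 * (a + b) - 2 * c"
      using e(3) by (simp add: algebra_simps)
    also have "\<dots> = 0"
      using e(1,2) by simp
    finally have "\<mu>\<^sup>2 - 2 * \<mu> - 2 = 0"
      using c(3) by simp
    then have "(\<mu> - 1)\<^sup>2 = 3"
      by (simp add: power2_eq_square algebra_simps)
    moreover have "\<mu> - 1 \<ge> 0"
    proof (rule ccontr)
      assume "\<not> \<mu> - 1 \<ge> 0"
      then have "\<mu> * a < 1 * a" "\<mu> * b < 1 * b"
        using c by (intro mult_strict_right_mono; simp)+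
      then show False using e c by linarith
    qed
    ultimately have "\<mu> - 1 = sqrt 3"
      by (metis real_sqrt_abs abs_of_nonneg)
    then show ?thesis by simp
  qed
  \<comment> \<open>If only one side differs from 1, the triangle inequality makes it exactly
    2.\<close>
  consider "p = 1" "q = 1" "r = 1" | "p = 2" "q = 1" "r = 1" | "p = 1" "q = 2" "r = 1"
    | "p = 1" "q = 1" "r = 2" | "p \<ge> 2" "q \<ge> 2" | "p \<ge> 2" "r \<ge> 2" | "q \<ge> 2" "r \<ge> 2"
    using int tri by linarith
  then show ?thesis
  proof cases
    case 1
    then have "(\<mu> - 2) * (x + y + z) = 0"
      using sum by (simp add: algebra_simps)
    then show ?thesis using pos by simp
  next
    case 2
    then show ?thesis using long[of x y z] eq pos by simp
  next
    case 3
    then show ?thesis using long[of x z y] eq pos by simp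
  next
    case 4
    then show ?thesis using long[of y z x] eq pos by simp
  next
    case 5
    then show ?thesis using two[of "p + q" "p + r" "q + r"] sum le3 ge1 by simp
  next
    case 6
    then show ?thesis using two[of "p + q" "p + r" "q + r"] sum le3 ge1 by simp
  next
    case 7
    then show ?thesis using two[of "p + q" "p + r" "q + r"] sum le3 ge1 by simp
  qed
qed

text \<open>The spectral argument uses only these metric laws. Intermediate points on geodesics are
  not part of them, so \<open>geodesic_in_spectrum\<close> takes its midpoint as given.\<close>

locale nat_metric =
  fixes d :: "'n::finite \<Rightarrow> 'n \<Rightarrow> nat"
  assumes zero_iff: "d i j = 0 \<longleftrightarrow> i = j"
    and sym: "d i j = d j i"
    and triangle: "d i k \<le> d i j + d j k"
begin

definition spectrum :: "real set" where
  "spectrum = {\<mu>. pareto_eigenvalue (\<chi> i j. real (d i j)) \<mu>}"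

lemma spectrum_iff:
  "\<mu> \<in> spectrum \<longleftrightarrow> (\<exists>J w. J \<noteq> {} \<and> (\<forall>i\<in>J. w i > 0) \<and>
    (\<forall>i\<in>J. (\<Sum>j\<in>J. real (d i j) * w j) = \<mu> * w i))"
  unfolding spectrum_def mem_Collect_eq by (subst pareto_eigenvalue_iff_support) simp_all

lemma finite_spectrum: "finite spectrum"
  unfolding spectrum_def by (rule finite_pareto_eigenvalues) (simp_all add: sym)

lemma d_self [simp]: "d i i = 0"
  by (simp add: zero_iff)

lemma d_ge_1: "i \<noteq> j \<Longrightarrow> d i j \<ge> 1"
  using zero_iff[of i j] by simp

section \<open>Column sums of distance submatrices\<close>

lemma column_sum_ge:
  assumes "j \<in> J"
  shows "(\<Sum>i\<in>J. real (d i j)) \<ge> real (card J) - 1"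
proof -
  have "(\<Sum>i\<in>J. real (d i j)) = (\<Sum>i\<in>J - {j}. real (d i j))"
    using assms by (subst sum.remove[of J j]) auto
  moreover have "(\<Sum>i\<in>J - {j}. real (d i j)) \<ge> (\<Sum>i\<in>J - {j}. 1)"
    using d_ge_1 by (intro sum_mono) force
  ultimately show ?thesis
    using assms by (simp add: card_Diff_singleton of_nat_diff card_gt_0_iff Suc_le_eq)
qed

lemma column_sum_eq_imp_d_eq_1:
  assumes "j \<in> J" "(\<Sum>i\<in>J. real (d i j)) \<le> real (card J) - 1" "i \<in> J" "i \<noteq> j"
  shows "d i j = 1"
proof (rule ccontr)
  assume "d i j \<noteq> 1"
  then have i: "real (d i j) > 1"
    using d_ge_1[OF assms(4)] by simp
  have "(\<Sum>i\<in>J. real (d i j)) = (\<Sum>i\<in>J - {j}. real (d i j))"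
    using assms by (subst sum.remove[of J j]) auto
  moreover have "(\<Sum>i\<in>J - {j}. real (d i j)) > (\<Sum>i\<in>J - {j}. 1)"
    using d_ge_1 i assms by (intro sum_strict_mono_ex1) force+
  ultimately show False
    using assms by (simp add: card_Diff_singleton of_nat_diff card_gt_0_iff Suc_le_eq)
qed

text \<open>Adding the eigenvector equations shows that, for positive weights, \<open>\<mu>\<close>
  is a weighted average of the column sums.\<close>

lemma mult_sum_eq_column_sums:
  assumes "\<And>i. i \<in> J \<Longrightarrow> (\<Sum>j\<in>J. real (d i j) * w j) = \<mu> * w i"
  shows "\<mu> * (\<Sum>i\<in>J. w i) = (\<Sum>j\<in>J. (\<Sum>i\<in>J. real (d i j)) * w j)"
proof -
  have "\<mu> * (\<Sum>i\<in>J. w i) = (\<Sum>i\<in>J. \<Sum>j\<in>J. real (d i j) * w j)"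
    unfolding sum_distrib_left using assms by (intro sum.cong) auto
  also have "\<dots> = (\<Sum>j\<in>J. \<Sum>i\<in>J. real (d i j) * w j)"
    by (rule sum.swap)
  finally show ?thesis by (simp add: sum_distrib_right)
qed

lemma spectrum_le_3_cases:
  assumes "\<mu> \<in> spectrum" "\<mu> \<le> 3"
  shows "\<mu> \<in> {0, 1, 2, 1 + sqrt 3} \<or>
    \<mu> = 3 \<and> ((\<exists>u v. d u v = 3) \<or> (\<exists>J. card J = 4 \<and> (\<forall>i\<in>J. \<forall>j\<in>J. i \<noteq> j \<longrightarrow> d i j = 1)))"
proof -
  obtain J w where J: "J \<noteq> {}" "\<And>i. i \<in> J \<Longrightarrow> w i > 0"
    and eq: "\<And>i. i \<in> J \<Longrightarrow> (\<Sum>j\<in>J. real (d i j) * w j) = \<mu> * w i"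
    using assms(1) unfolding spectrum_iff by blast
  have "card J > 0"
    using J by (simp add: card_gt_0_iff)
  then consider "card J = 1" | "card J = 2" | "card J = 3" | "card J \<ge> 4"
    by linarith
  then show ?thesis
  proof cases
    case 1
    then obtain a where a: "J = {a}"
      by (auto simp: card_1_singleton_iff)
    then have "\<mu> * w a = 0" "w a > 0"
      using eq[of a] J by simp_all
    then show ?thesis by simp
  next
    case 2
    then obtain a b where ab: "J = {a, b}" "a \<noteq> b"
      by (auto simp: card_2_iff)
    then have w: "w a > 0" "w b > 0"
      using J by auto
    have e: "real (d a b) * w b = \<mu> * w a" "real (d a b) * w a = \<mu> * w b"
      using eq[of a] eq[of b] ab sym[of a b] by simp_all
    then have "(\<mu> - real (d a b)) * (w a + w b) = 0"
      by (simp add: algebra_simps)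
    then have "\<mu> = real (d a b)"
      using w by simp
    moreover have "d a b = 0 \<or> d a b = 1 \<or> d a b = 2 \<or> d a b = 3"
      using assms(2) calculation by linarith
    ultimately show ?thesis
      by auto
  next
    case 3
    then obtain a b c where abc: "J = {a, b, c}" "a \<noteq> b" "a \<noteq> c" "b \<noteq> c"
      by (auto simp: card_3_iff)
    have w: "w a > 0" "w b > 0" "w c > 0"
      using J abc by auto
    have e: "\<mu> * w a = real (d a b) * w b + real (d a c) * w c"
      "\<mu> * w b = real (d a b) * w a + real (d b c) * w c"
      "\<mu> * w c = real (d a c) * w a + real (d b c) * w b"
      using eq[of a] eq[of b] eq[of c] abc sym[of a b] sym[of a c] sym[of b c] by simp_all
    have "real (d a b) \<le> real (d a c) + real (d b c)"
      "real (d a c) \<le> real (d a b) + real (d b c)"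
      "real (d b c) \<le> real (d a b) + real (d a c)"
      using triangle[of a b c] triangle[of a c b] triangle[of b c a]
        sym[of a b] sym[of a c] sym[of b c] by linarith+
    moreover have "d a b \<ge> 1" "d a c \<ge> 1" "d b c \<ge> 1"
      using abc d_ge_1 by auto
    moreover have "real n \<ge> 1" "real n = 1 \<or> real n \<ge> 2" if "n \<ge> 1" for n
      using that by (cases "n = 1"; simp)+
    ultimately have "\<mu> = 2 \<or> \<mu> = 1 + sqrt 3"
      using triangle_equation_root[OF _ _ _ _ _ _ _ _ _ w e assms(2)] by simp
    then show ?thesis by auto
  next
    case 4
    \<comment> \<open>All column sums are at least \<open>card J - 1 \<ge> 3 \<ge> \<mu>\<close>,
      while their weighted average is \<open>\<mu>\<close>. Hence every one equals 3, which is the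
      equality case of the column bound for four mutually adjacent points.\<close>
    define s where "s j = (\<Sum>i\<in>J. real (d i j))" for j
    have s: "s j \<ge> real (card J) - 1" if "j \<in> J" for j
      using column_sum_ge[OF that] by (simp add: s_def)
    have ge: "(s j - \<mu>) * w j \<ge> 0" if "j \<in> J" for j
      using s[OF that] J(2)[OF that] 4 assms(2) by simp
    have "(\<Sum>j\<in>J. (s j - \<mu>) * w j) = 0"
      using mult_sum_eq_column_sums[OF eq]
      by (simp add: s_def left_diff_distrib sum_subtractf sum_distrib_left)
    then have "\<forall>j\<in>J. (s j - \<mu>) * w j = 0"
      using ge by (subst (asm) sum_nonneg_eq_0_iff) auto
    then have s_eq: "s j = \<mu>" if "j \<in> J" for j
      using that J(2)[OF that] by auto
    obtain a where "a \<in> J" using J(1) by blast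
    then have mu: "\<mu> = 3" and "card J = 4"
      using s[of a] s_eq[of a] 4 assms(2) by linarith+
    moreover have "d i j = 1" if "i \<in> J" "j \<in> J" "i \<noteq> j" for i j
      using column_sum_eq_imp_d_eq_1[of j J i] that s_eq[of j] mu \<open>card J = 4\<close>
      by (simp add: s_def)
    ultimately show ?thesis by blast
  qed
qed

section \<open>Eigenvalues realised by explicit supports\<close>

lemma zero_in_spectrum: "0 \<in> spectrum"
  unfolding spectrum_iff
  by (rule exI[of _ "{undefined}"], rule exI[of _ "\<lambda>_. 1"]) simp

lemma distance_in_spectrum:
  assumes "u \<noteq> v"
  shows "real (d u v) \<in> spectrum"
  unfolding spectrum_iff using assms sym[of u v]
  by (intro exI[of _ "{u, v}"] exI[of _ "\<lambda>_. 1"]) simp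

lemma geodesic_in_spectrum:
  assumes "d a c = 1" "d c b = 1" "d a b = 2"
  shows "1 + sqrt 3 \<in> spectrum"
proof -
  have ne: "a \<noteq> b" "a \<noteq> c" "c \<noteq> b"
    using assms by auto
  \<comment> \<open>Keeps the midpoint weight \<open>sqrt 3 - 1\<close> positive. The equation at
    \<open>a\<close> and \<open>b\<close> reads \<open>2 + (sqrt 3 - 1) = 1 + sqrt 3\<close>; at
    \<open>c\<close> it reads \<open>2 = (1 + sqrt 3) * (sqrt 3 - 1)\<close>.\<close>
  have "sqrt 3 > 1" by simp
  then show ?thesis
    unfolding spectrum_iff using assms ne sym[of b a] sym[of b c] sym[of c a]
    by (intro exI[of _ "{a, b, c}"] exI[of _ "\<lambda>i. if i = c then sqrt 3 - 1 else 1"])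
      (auto simp: algebra_simps)
qed

text \<open>All column sums on a clique agree, so the constant vector is an eigenvector.\<close>

lemma clique_in_spectrum:
  assumes "J \<noteq> {}" "\<And>i j. i \<in> J \<Longrightarrow> j \<in> J \<Longrightarrow> i \<noteq> j \<Longrightarrow> d i j = 1"
  shows "real (card J) - 1 \<in> spectrum"
proof -
  have "(\<Sum>j\<in>J. real (d i j)) = real (card J) - 1" if "i \<in> J" for i
  proof -
    have "(\<Sum>j\<in>J. real (d i j)) = (\<Sum>j\<in>J - {i}. real (d i j))"
      using that by (subst sum.remove[of J i]) auto
    also have "\<dots> = (\<Sum>j\<in>J - {i}. 1)"
      using that assms(2) by (intro sum.cong) auto
    also have "\<dots> = real (card J) - 1"
      using that card_gt_0_iff[of J] by (auto simp: card_Diff_singleton of_nat_diff)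
    finally show ?thesis .
  qed
  then show ?thesis
    unfolding spectrum_iff using assms(1)
    by (intro exI[of _ J] exI[of _ "\<lambda>_. 1"]) simp
qed

text \<open>The Rayleigh quotient of the all-ones vector is the average column sum. With at least
  four vertices this supplies a value that is at least 3.\<close>

lemma ex_spectrum_ge_card:
  "\<exists>\<mu>\<in>spectrum. \<mu> \<ge> real CARD('n) - 1"
proof -
  define A :: "real ^ 'n ^ 'n" where "A = (\<chi> i j. real (d i j))"
  define v :: "real ^ 'n" where "v = (\<chi> i. 1)"
  have "\<exists>\<mu>. pareto_eigenvalue A \<mu> \<and> \<mu> \<ge> (v \<bullet> (A *v v)) / (v \<bullet> v)"
    by (rule ex_pareto_eigenvalue_ge_quadratic_form)
      (simp_all add: A_def v_def vec_eq_iff sym)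
  moreover have "(v \<bullet> (A *v v)) / (v \<bullet> v) \<ge> real CARD('n) - 1"
  proof -
    have "v \<bullet> (A *v v) = (\<Sum>i\<in>UNIV. \<Sum>j\<in>UNIV. real (d j i))"
      by (simp add: inner_vec_def matrix_vector_mult_def A_def v_def sym)
    also have "\<dots> \<ge> (\<Sum>i\<in>(UNIV :: 'n set). real CARD('n) - 1)"
      by (intro sum_mono column_sum_ge) simp
    finally have "v \<bullet> (A *v v) \<ge> (real CARD('n) - 1) * real CARD('n)"
      by (simp add: mult.commute)
    moreover have "v \<bullet> v = real CARD('n)"
      by (simp add: inner_vec_def v_def)
    ultimately show ?thesis
      by (simp add: le_divide_eq)
  qed
  ultimately show ?thesis
    unfolding spectrum_def A_def by force
qed

end

section \<open>The fifth smallest element\<close>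

lemma kth_smallest_eqI:
  assumes "finite S" "x \<in> S" "Suc (card {y \<in> S. y < x}) = k"
  shows "kth_smallest k S = x"
  unfolding kth_smallest_def
proof (rule the_equality)
  show "x \<in> S \<and> finite {y \<in> S. y < x} \<and> Suc (card {y \<in> S. y < x}) = k"
    using assms by simp
next
  \<comment> \<open>Strict monotonicity of the counting function on \<open>S\<close> gives the
    uniqueness that \<open>THE\<close> requires.\<close>
  have less: "card {y \<in> S. y < a} < card {y \<in> S. y < b}" if "a \<in> S" "a < b" for a b
    using that assms(1) by (intro psubset_card_mono) auto
  fix z assume "z \<in> S \<and> finite {y \<in> S. y < z} \<and> Suc (card {y \<in> S. y < z}) = k"
  then show "z = x"
    using less[of x z] less[of z x] assms by (cases x z rule: linorder_cases) auto
qed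

text \<open>Once the part \<open>F\<close> below \<open>c\<close> is known, the next element is the
  minimum of the part from \<open>c\<close> on; \<open>z\<close> guarantees that this part is
  nonempty. It is applied with \<open>c = 3\<close> and a four-element \<open>F\<close>.\<close>

lemma Suc_card_less_kth_smallest:
  assumes "finite S" "{y \<in> S. y < c} = F" "z \<in> S" "z \<ge> c"
  shows "card S \<ge> Suc (card F)"
    and "kth_smallest (Suc (card F)) S \<ge> c"
    and "kth_smallest (Suc (card F)) S = c \<longleftrightarrow> c \<in> S"
proof -
  define m where "m = Min {y \<in> S. y \<ge> c}"
  have fin: "finite {y \<in> S. y \<ge> c}" using assms(1) by simp
  have mS: "m \<in> S" "m \<ge> c"
    using Min_in[OF fin] assms(3,4) unfolding m_def by blast+
  have least: "m \<le> y" if "y \<in> S" "y \<ge> c" for y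
    unfolding m_def using fin that by simp
  have F: "{y \<in> S. y < m} = F"
    using assms(2) mS least by force
  then have kth: "kth_smallest (Suc (card F)) S = m"
    using kth_smallest_eqI[OF assms(1) mS(1)] by simp
  have "insert m F \<subseteq> S" "m \<notin> F" "finite F"
    using F mS assms(1) by auto
  then show "card S \<ge> Suc (card F)"
    using card_mono[OF assms(1), of "insert m F"] by simp
  show "kth_smallest (Suc (card F)) S \<ge> c"
    using kth mS by simp
  show "kth_smallest (Suc (card F)) S = c \<longleftrightarrow> c \<in> S"
    using kth mS least[of c] by auto
qed

section \<open>Distances in a connected graph\<close>

text \<open>Trades walks for relation powers, whose composition laws yield the metric laws.
  Membership of \<open>u\<close> in \<open>verts G\<close> is what the empty walk demands.\<close>

lemma (in wf_digraph) ex_awalk_length_iff_relpow: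
  assumes "u \<in> verts G"
  shows "(\<exists>p. awalk u p v \<and> length p = k) \<longleftrightarrow> (u, v) \<in> arcs_ends G ^^ k"
  using assms
proof (induction k arbitrary: u)
  case 0
  then show ?case by (auto simp: awalk_Nil_iff)
next
  case (Suc k)
  have "(\<exists>p. awalk u p v \<and> length p = Suc k) \<longleftrightarrow>
      (\<exists>e\<in>arcs G. tail G e = u \<and> (\<exists>p. awalk (head G e) p v \<and> length p = k))"
    unfolding length_Suc_conv by (metis awalk_Cons_iff)
  also have "\<dots> \<longleftrightarrow> (\<exists>e\<in>arcs G. tail G e = u \<and> (head G e, v) \<in> arcs_ends G ^^ k)"
    using Suc.IH by auto
  also have "\<dots> \<longleftrightarrow> (\<exists>x. (u, x) \<in> arcs_ends G \<and> (x, v) \<in> arcs_ends G ^^ k)"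
    by (auto simp: arcs_ends_conv)
  also have "\<dots> \<longleftrightarrow> (u, v) \<in> arcs_ends G ^^ Suc k"
    by (metis relpow_Suc_I2 relpow_Suc_D2)
  finally show ?case .
qed

text \<open>\<open>graph_dist\<close> minimises over paths, relation powers over walks. The minima
  agree because a shortest walk is a path: cutting out a cycle would shorten it.\<close>

lemma (in wf_digraph) graph_dist_eq_Least_relpow:
  assumes "u \<in> verts G" "(u, v) \<in> arcs_ends G ^^ n"
  shows "graph_dist G u v = (LEAST k. (u, v) \<in> arcs_ends G ^^ k)"
proof -
  define k where "k = (LEAST k. (u, v) \<in> arcs_ends G ^^ k)"
  have "(u, v) \<in> arcs_ends G ^^ k"
    unfolding k_def using assms(2) by (rule LeastI)
  then obtain p where p: "awalk u p v" "length p = k"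
    using ex_awalk_length_iff_relpow[OF assms(1)] by blast
  have ge: "k \<le> length q" if "apath u q v" for q
  proof -
    have "(u, v) \<in> arcs_ends G ^^ length q"
      using awalkI_apath[OF that] ex_awalk_length_iff_relpow[OF assms(1)] by blast
    then show ?thesis
      unfolding k_def by (rule Least_le)
  qed
  have "distinct (awalk_verts u p)"
  proof (rule ccontr)
    assume nd: "\<not> distinct (awalk_verts u p)"
    obtain q r s where "awalk_cyc_decomp p = (q, r, s)"
      by (cases "awalk_cyc_decomp p") auto
    then have "is_awalk_cyc_decomp p (q, r, s)"
      using awalk_cyc_decomp_has_prop[OF p(1) nd] by auto
    then have "length (q @ s) < length p" "awalk u (q @ s) v"
      using p by (auto dest!: awalk_ends_eqD)
    then have "(u, v) \<in> arcs_ends G ^^ length (q @ s)"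
      using ex_awalk_length_iff_relpow[OF assms(1)] by blast
    then have "k \<le> length (q @ s)"
      unfolding k_def by (rule Least_le)
    with \<open>length (q @ s) < length p\<close> show False
      using p(2) by simp
  qed
  then have "apath u p v"
    using p by (simp add: apath_def)
  then show ?thesis
    unfolding graph_dist_def k_def[symmetric] using p ge by (intro Least_equality) auto
qed

locale connected_graph_UNIV = graph G for G :: "('n::finite, 'b) pre_digraph" (structure) +
  assumes verts_UNIV: "verts G = UNIV"
    and connected: "Digraph_Component.connected G"
begin

section \<open>The metric laws of the graph distance\<close>

lemma ex_relpow: "\<exists>k. (u, v) \<in> arcs_ends G ^^ k"
proof -
  \<comment> \<open>Connectedness refers to the symmetric closure, which has the same reachability
    because the arcs are already symmetric.\<close>
  have "u \<rightarrow>\<^sup>*\<^bsub>mk_symmetric G\<^esub> v"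
    using connected verts_UNIV unfolding connected_def strongly_connected_def by simp
  then have "u \<rightarrow>\<^sup>* v"
    using reachable_mk_symmetric_eq[OF sym_arcs] by blast
  then show ?thesis
    using ex_awalk_length_iff_relpow verts_UNIV unfolding reachable_awalk by blast
qed

lemma relpow_graph_dist: "(u, v) \<in> arcs_ends G ^^ graph_dist G u v"
proof -
  obtain n where n: "(u, v) \<in> arcs_ends G ^^ n"
    using ex_relpow by blast
  then show ?thesis
    using graph_dist_eq_Least_relpow[OF _ n] verts_UNIV LeastI[of _ n] by simp
qed

lemma graph_dist_le: "(u, v) \<in> arcs_ends G ^^ n \<Longrightarrow> graph_dist G u v \<le> n"
  using graph_dist_eq_Least_relpow[of u v n] verts_UNIV by (simp add: Least_le)

lemma relpow_arcs_ends_sym: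
  assumes "(u, v) \<in> arcs_ends G ^^ n"
  shows "(v, u) \<in> arcs_ends G ^^ n"
  using assms
proof (induction n arbitrary: v)
  case (Suc n)
  then obtain w where "(u, w) \<in> arcs_ends G ^^ n" "(w, v) \<in> arcs_ends G"
    by auto
  then show ?case
    using Suc.IH sym_arcs by (meson arcs_ends_symmetric relpow_Suc_I2)
qed simp

sublocale nat_metric "graph_dist G"
proof
  fix i j k
  show "graph_dist G i j = 0 \<longleftrightarrow> i = j"
    using relpow_graph_dist[of i j] graph_dist_le[of i j 0] by auto
  show "graph_dist G i j = graph_dist G j i"
    by (meson graph_dist_le relpow_graph_dist relpow_arcs_ends_sym order_antisym)
  have "(i, k) \<in> arcs_ends G ^^ (graph_dist G i j + graph_dist G j k)"
    unfolding relpow_add using relpow_graph_dist by blast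
  then show "graph_dist G i k \<le> graph_dist G i j + graph_dist G j k"
    by (rule graph_dist_le)
qed

lemma spectrum_eq: "spectrum = distance_pareto_eigenvalues G"
  by (simp add: spectrum_def distance_pareto_eigenvalues_def distance_matrix_def)

lemma graph_dist_eq_1_iff: "graph_dist G u v = 1 \<longleftrightarrow> (u, v) \<in> arcs_ends G"
proof
  assume "graph_dist G u v = 1"
  then show "(u, v) \<in> arcs_ends G"
    using relpow_graph_dist[of u v] by simp
next
  assume uv: "(u, v) \<in> arcs_ends G"
  then have "u \<noteq> v"
    using no_loops by (auto simp: arcs_ends_conv)
  then show "graph_dist G u v = 1"
    using graph_dist_le[of u v 1] uv d_ge_1[of u v] by simp
qed

text \<open>The vertex \<open>w\<close> is the last one before \<open>v\<close> on a shortest walk;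
  the triangle inequality keeps it from being closer to \<open>u\<close> than
  \<open>k\<close>.\<close>

lemma graph_dist_SucE:
  assumes "graph_dist G u v = Suc k"
  obtains w where "graph_dist G u w = k" "graph_dist G w v = 1"
proof -
  obtain w where w: "(u, w) \<in> arcs_ends G ^^ k" "(w, v) \<in> arcs_ends G"
    using relpow_graph_dist[of u v] assms by auto
  then have "graph_dist G w v = 1"
    by (simp only: graph_dist_eq_1_iff)
  moreover have "graph_dist G u w = k"
    using graph_dist_le[OF w(1)] triangle[of u v w] calculation assms by simp
  ultimately show thesis by (rule that[rotated])
qed

text \<open>Stepping back from \<open>v\<close> along a geodesic lowers the distance from
  \<open>u\<close> by one at a time, so no value is skipped.\<close>

lemma ex_graph_dist_eq:
  assumes "k \<le> graph_dist G u v"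
  shows "\<exists>w. graph_dist G u w = k"
  using assms
proof (induction "graph_dist G u v" arbitrary: v)
  case 0
  then show ?case by auto
next
  case (Suc n)
  then show ?case
    by (metis graph_dist_SucE le_Suc_eq)
qed

text \<open>A missing edge has end points at distance at least 2. Some vertex is then at distance
  exactly 2 from one end, and its predecessor on a geodesic is the midpoint.\<close>

lemma ex_graph_dist_2:
  assumes "\<not> complete_digraph (card (verts G)) G"
  obtains u w v where "graph_dist G u w = 1" "graph_dist G w v = 1" "graph_dist G u v = 2"
proof -
  have "graph G" by unfold_locales
  then have "arcs_ends G \<noteq> {(u, v). u \<noteq> v}"
    using assms verts_UNIV by (simp add: complete_digraph_def)
  moreover have "arcs_ends G \<subseteq> {(u, v). u \<noteq> v}"
    using no_loops by (auto simp: arcs_ends_conv)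
  ultimately obtain a b where "a \<noteq> b" "(a, b) \<notin> arcs_ends G"
    by blast
  then have "2 \<le> graph_dist G a b"
    using d_ge_1[of a b] graph_dist_eq_1_iff[of a b] by linarith
  then obtain v where "graph_dist G a v = Suc 1"
    using ex_graph_dist_eq by (metis Suc_1)
  then show thesis
    using that by (metis Suc_1 graph_dist_SucE)
qed

text \<open>The attained distances are downward closed by \<open>ex_graph_dist_eq\<close>, so a
  bound on the maximum becomes an exact value.\<close>

lemma graph_diameter_ge_iff: "graph_diameter G \<ge> k \<longleftrightarrow> (\<exists>u v. graph_dist G u v = k)"
proof -
  have eq: "{graph_dist G u v |u v. u \<in> verts G \<and> v \<in> verts G} = case_prod (graph_dist G) ` UNIV"
    using verts_UNIV by auto
  have "graph_diameter G \<ge> k \<longleftrightarrow> (\<exists>u v. k \<le> graph_dist G u v)"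
    unfolding graph_diameter_def eq by (subst Max_ge_iff) auto
  then show ?thesis
    using ex_graph_dist_eq by (metis order_refl)
qed

text \<open>Cliques are the sets with all mutual distances 1, and subsets of cliques are cliques, so
  a lower bound on the maximum becomes an exact size.\<close>

lemma clique_number_ge_iff:
  "clique_number G \<ge> k \<longleftrightarrow>
    (\<exists>J. card J = k \<and> (\<forall>i\<in>J. \<forall>j\<in>J. i \<noteq> j \<longrightarrow> graph_dist G i j = 1))"
proof -
  define C where "C = {k. \<exists>H. subgraph H G \<and> complete_digraph k H}"
  have C_iff: "n \<in> C \<longleftrightarrow> (\<exists>J. card J = n \<and> (\<forall>i\<in>J. \<forall>j\<in>J. i \<noteq> j \<longrightarrow> graph_dist G i j = 1))" for n
  proof
    assume "n \<in> C"
    then obtain H where H: "subgraph H G" "complete_digraph n H"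
      unfolding C_def by blast
    have "arcs_ends H \<subseteq> arcs_ends G"
      using arcs_ends_mono[OF H(1)] .
    then show "\<exists>J. card J = n \<and> (\<forall>i\<in>J. \<forall>j\<in>J. i \<noteq> j \<longrightarrow> graph_dist G i j = 1)"
      using H(2) unfolding graph_dist_eq_1_iff complete_digraph_def
      by (intro exI[of _ "verts H"]) auto
  next
    assume "\<exists>J. card J = n \<and> (\<forall>i\<in>J. \<forall>j\<in>J. i \<noteq> j \<longrightarrow> graph_dist G i j = 1)"
    then obtain J where J: "card J = n" "\<And>i j. i \<in> J \<Longrightarrow> j \<in> J \<Longrightarrow> i \<noteq> j \<Longrightarrow> (i, j) \<in> arcs_ends G"
      unfolding graph_dist_eq_1_iff by blast
    \<comment> \<open>The induced subgraph is the complete subgraph on \<open>J\<close>.\<close>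
    have sub: "subgraph (G \<restriction> J) G"
      by (rule subgraph_induce_subgraphI) (simp add: verts_UNIV)
    have ends: "arcs_ends (G \<restriction> J) = {(u, v). u \<in> J \<and> v \<in> J \<and> u \<noteq> v}"
      using J(2) no_loops by (force simp: arcs_ends_conv)
    interpret H: digraph "G \<restriction> J"
      using sub by (rule digraph_subgraph)
    have "graph (G \<restriction> J)"
      by unfold_locales (auto simp: symmetric_def ends sym_def)
    then have "complete_digraph n (G \<restriction> J)"
      using J(1) ends by (simp add: complete_digraph_def)
    then show "n \<in> C"
      unfolding C_def using sub by blast
  qed
  have "finite C"
    unfolding finite_nat_set_iff_bounded_le
    using C_iff card_mono[of "UNIV :: 'n set"] by (metis finite_UNIV subset_UNIV finite)
  \<comment> \<open>The empty clique makes \<open>C\<close> nonempty, so its \<open>Max\<close> is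
    meaningful.\<close>
  moreover have "0 \<in> C"
    unfolding C_iff by (intro exI[of _ "{}"]) simp
  ultimately have "clique_number G \<ge> k \<longleftrightarrow> (\<exists>n\<in>C. k \<le> n)"
    unfolding clique_number_def C_def[symmetric] by (subst Max_ge_iff) auto
  also have "\<dots> \<longleftrightarrow> k \<in> C"
  proof
    assume "\<exists>n\<in>C. k \<le> n"
    then obtain n where "n \<in> C" "k \<le> n" by blast
    then obtain J where J: "k \<le> card J" "\<forall>i\<in>J. \<forall>j\<in>J. i \<noteq> j \<longrightarrow> graph_dist G i j = 1"
      using C_iff[of n] by auto
    obtain J' where "J' \<subseteq> J" "card J' = k"
      using J(1) by (meson obtain_subset_with_card_n)
    then show "k \<in> C"
      unfolding C_iff using J(2) by (intro exI[of _ J']) auto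
  qed auto
  finally show ?thesis
    unfolding C_iff .
qed

section \<open>The distance Pareto spectrum up to 3\<close>

lemma three_in_spectrum_iff:
  "3 \<in> spectrum \<longleftrightarrow> clique_number G \<ge> 4 \<or> graph_diameter G \<ge> 3"
proof
  assume "3 \<in> spectrum"
  \<comment> \<open>Excludes the short list in \<open>spectrum_le_3_cases\<close>, leaving a pair at
    distance 3 or a 4-clique.\<close>
  moreover have "(3 :: real) \<noteq> 1 + sqrt 3"
    using real_sqrt_less_mono[of 3 4] by simp
  ultimately show "clique_number G \<ge> 4 \<or> graph_diameter G \<ge> 3"
    using spectrum_le_3_cases[of 3] by (auto simp: clique_number_ge_iff graph_diameter_ge_iff)
next
  assume "clique_number G \<ge> 4 \<or> graph_diameter G \<ge> 3"
  then show "3 \<in> spectrum"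
  proof
    assume "clique_number G \<ge> 4"
    then obtain J where J: "card J = 4" "\<forall>i\<in>J. \<forall>j\<in>J. i \<noteq> j \<longrightarrow> graph_dist G i j = 1"
      unfolding clique_number_ge_iff by blast
    then have "real (card J) - 1 \<in> spectrum"
      by (intro clique_in_spectrum) auto
    then show ?thesis using J(1) by simp
  next
    assume "graph_diameter G \<ge> 3"
    then obtain u v where "graph_dist G u v = 3"
      unfolding graph_diameter_ge_iff by blast
    then show ?thesis
      using distance_in_spectrum[of u v] by fastforce
  qed
qed

text \<open>A geodesic of length two realises all four values: a single vertex, its pairs at
  distances 1 and 2, and the whole triple.\<close>

lemma spectrum_less_3:
  assumes "\<not> complete_digraph (card (verts G)) G"
  shows "{\<mu> \<in> spectrum. \<mu> < 3} = {0, 1, 2, 1 + sqrt 3}"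
proof -
  obtain u w v where uwv: "graph_dist G u w = 1" "graph_dist G w v = 1" "graph_dist G u v = 2"
    using ex_graph_dist_2[OF assms] .
  then have "u \<noteq> w" "u \<noteq> v" by auto
  then have "1 \<in> spectrum" "2 \<in> spectrum"
    using distance_in_spectrum[of u w] distance_in_spectrum[of u v] uwv by simp_all
  moreover have "sqrt 3 < 2"
    using real_sqrt_less_mono[of 3 4] by simp
  ultimately show ?thesis
    using zero_in_spectrum geodesic_in_spectrum[OF uwv] spectrum_le_3_cases
    by (auto dest: less_imp_le)
qed

end

text \<open>The cardinality conjunct ensures that a fifth smallest value exists, so
  \<open>distance_pareto_mu 5 G\<close> is not an unspecified \<open>THE\<close> term.\<close>

theorem theorem4p3:
  fixes G :: "('n::finite, 'b) pre_digraph"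
  assumes "Digraph.graph G"
    and "verts G = UNIV"
    and "Digraph_Component.connected G"
    and "\<not> complete_digraph (card (verts G)) G"
    and "card (verts G) \<ge> 4"
  shows "card (distance_pareto_eigenvalues G) \<ge> 5
    \<and> distance_pareto_mu 5 G \<ge> 3
    \<and> (distance_pareto_mu 5 G = 3 \<longleftrightarrow> clique_number G \<ge> 4 \<or> graph_diameter G \<ge> 3)"
proof -
  interpret connected_graph_UNIV G
    using assms(1-3) by (simp add: connected_graph_UNIV_def connected_graph_UNIV_axioms_def)
  obtain \<mu> where mu: "\<mu> \<in> spectrum" "\<mu> \<ge> 3"
    using ex_spectrum_ge_card assms(2,5) by fastforce
  \<comment> \<open>Distinctness of the four values below 3, so that exactly four elements precede
    the one selected by index 5.\<close>
  have "1 + sqrt 3 > 2"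
    by simp
  then have "1 + sqrt 3 \<noteq> 0" "1 + sqrt 3 \<noteq> 1" "1 + sqrt 3 \<noteq> 2"
    by linarith+
  then have "card {1 + sqrt 3, 0, 1, 2} = 4"
    by simp
  then have "Suc (card {0, 1, 2, 1 + sqrt 3}) = 5"
    by (simp add: insert_commute)
  then show ?thesis
    using Suc_card_less_kth_smallest[OF finite_spectrum spectrum_less_3[OF assms(4)] mu]
      three_in_spectrum_iff
    unfolding distance_pareto_mu_def spectrum_eq by simp
qed

end
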